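(* Let $D$ be the set of $\beta\in(1,2]$ such that the symmetric tent map $f_\beta$ has finite critical orbit. Then $D$ is dense in $(1,2]$, and for each $\beta\in D$, $$\sum_{n=1}^{\infty}F_{\beta,n}\,a_{\beta,n}<+\infty .$$
   Context: For $1<\beta\le2$, $f_\beta:[0,1]\to[0,1]$ is $f_\beta(x)=\beta x$ for $0\le x\le\frac12$ and $f_\beta(x)=\beta(1-x)$ for $\frac12<x\le1$, with critical point $c=\frac12$. The critical orbit is $\mathrm{orb}(c)=\{f_\beta^i(c):i\ge0\}$. When it is finite, write $\mathrm{orb}(c)=\{c_0,c_1,\dots,c_{t+m-1}\}$ (distinct points) with $c_i=f_\beta^i(c)$, where $c_t$ is periodic of period $m$ (so $f_\beta(c_{t+m-1})=c_t$). For $n\ge 0$ put $$C_{\beta,n}=\{x\in[0,1]: f_\beta^n(x)=c_t,\ f_\beta^s(x)\ne c_t\ \text{for } 0\le s<n\},$$ let $F_{\beta,n}$ be the cardinality of $C_{\beta,n}$, and for $n\ge1$ put $a_{\beta,n}=\dfrac{1}{\beta^n}\dfrac{2}{n(n+1)}$. *)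

theory Defs
  imports "HOL-Analysis.Analysis"
begin

(* The map is given by its two-branch formula on all of real; only its restriction to {0..1},
   which it maps into itself for 1 < \<beta> \<le> 2 (tent_maps_unit), is ever used. *)
definition tent :: "real \<Rightarrow> real \<Rightarrow> real" where
  "tent \<beta> x = (if x \<le> 1/2 then \<beta> * x else \<beta> * (1 - x))"

definition crit :: real where
  "crit = 1/2"

definition crit_iter :: "real \<Rightarrow> nat \<Rightarrow> real" where
  "crit_iter \<beta> i = (tent \<beta> ^^ i) crit"

definition crit_orbit :: "real \<Rightarrow> real set" where
  "crit_orbit \<beta> = range (crit_iter \<beta>)"

definition finite_orbit_params :: "real set" where
  "finite_orbit_params = {\<beta> \<in> {1<..2}. finite (crit_orbit \<beta>)}"

(* Injectivity on {..<t + m} makes t the exact preperiod and m the exact period. *)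
definition orbit_shape :: "real \<Rightarrow> nat \<Rightarrow> nat \<Rightarrow> bool" where
  "orbit_shape \<beta> t m \<longleftrightarrow>
     0 < m \<and> crit_orbit \<beta> = crit_iter \<beta> ` {..<t + m} \<and> inj_on (crit_iter \<beta>) {..<t + m} \<and>
     tent \<beta> (crit_iter \<beta> (t + m - 1)) = crit_iter \<beta> t"

(* Well defined for a finite critical orbit, by orbit_shape_exists and orbit_shape_unique. *)
definition preperiod :: "real \<Rightarrow> nat" where
  "preperiod \<beta> = (THE t. \<exists>m. orbit_shape \<beta> t m)"

definition C_set :: "real \<Rightarrow> nat \<Rightarrow> real set" where
  "C_set \<beta> n = {x \<in> {0..1}. (tent \<beta> ^^ n) x = crit_iter \<beta> (preperiod \<beta>) \<and>
                  (\<forall>s<n. (tent \<beta> ^^ s) x \<noteq> crit_iter \<beta> (preperiod \<beta>))}"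

(* card is the true cardinality here, by finite_C_set. *)
definition F_num :: "real \<Rightarrow> nat \<Rightarrow> nat" where
  "F_num \<beta> n = card (C_set \<beta> n)"

definition a_coeff :: "real \<Rightarrow> nat \<Rightarrow> real" where
  "a_coeff \<beta> n = 1 / \<beta> ^ n * (2 / (real n * (real n + 1)))"

lemma tent_maps_unit:
  assumes "1 < \<beta>" "\<beta> \<le> 2" "x \<in> {0..1}"
  shows "tent \<beta> x \<in> {0..1}"
proof -
  have "\<beta> * y \<in> {0..1}" if "0 \<le> y" "y \<le> 1/2" for y
    using mult_mono[of \<beta> 2 y "1/2"] assms that by auto
  then show ?thesis using assms by (auto simp: tent_def)
qed

lemma finite_tent_preimage:
  assumes "1 < \<beta>"
  shows "finite {x. (tent \<beta> ^^ n) x = y}"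
proof (induction n arbitrary: y)
  case 0
  then show ?case by simp
next
  case (Suc n)
  have "{x. (tent \<beta> ^^ Suc n) x = y} \<subseteq>
          {x. (tent \<beta> ^^ n) x = y / \<beta>} \<union> {x. (tent \<beta> ^^ n) x = 1 - y / \<beta>}"
    using assms by (auto simp: tent_def field_simps split: if_splits)
  then show ?case
    using Suc.IH finite_subset by blast
qed

lemma finite_C_set:
  assumes "1 < \<beta>"
  shows "finite (C_set \<beta> n)"
  by (rule finite_subset[OF _ finite_tent_preimage[OF assms, of n "crit_iter \<beta> (preperiod \<beta>)"]])
    (auto simp: C_set_def)

lemma orbit_shape_exists:
  assumes "finite (crit_orbit \<beta>)"
  shows "\<exists>t m. orbit_shape \<beta> t m"
proof -
  let ?c = "crit_iter \<beta>"
  have c_Suc: "?c (Suc i) = tent \<beta> (?c i)" for i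
    by (simp add: crit_iter_def)
  have "\<not> inj ?c"
    using assms finite_imageD[of ?c UNIV] by (auto simp: crit_orbit_def)
  then obtain i j where "?c i = ?c j" "i < j"
    unfolding inj_on_def by (metis linorder_neqE_nat)
  then have ex: "\<exists>N. ?c N \<in> ?c ` {..<N}"
    by (metis imageI lessThan_iff)
  define N where "N = (LEAST N. ?c N \<in> ?c ` {..<N})"
  have N: "?c N \<in> ?c ` {..<N}"
    unfolding N_def using LeastI_ex[OF ex] .
  have least: "?c k \<notin> ?c ` {..<k}" if "k < N" for k
    using not_less_Least that unfolding N_def by blast
  obtain t where t: "t < N" "?c N = ?c t"
    using N by auto
  have inj: "inj_on ?c {..<N}"
  proof (rule linorder_inj_onI)
    fix x y assume "x < y" "x \<in> {..<N}" "y \<in> {..<N}"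
    then show "?c x \<noteq> ?c y" using least[of y] by (metis imageI lessThan_iff)
  qed auto
  have mem: "?c k \<in> ?c ` {..<N}" for k
  proof (induction k)
    case 0
    then show ?case using t by auto
  next
    case (Suc k)
    then obtain j where j: "j < N" "?c k = ?c j" by auto
    then have "?c (Suc k) = ?c (Suc j)" by (simp add: c_Suc)
    then show ?case
      using j N by (cases "Suc j = N") auto
  qed
  have "tent \<beta> (?c (N - 1)) = ?c t"
    using t c_Suc[of "N - 1"] by simp
  then have "orbit_shape \<beta> t (N - t)"
    using t inj mem by (auto simp: orbit_shape_def crit_orbit_def)
  then show ?thesis by blast
qed

lemma orbit_shape_unique:
  assumes "orbit_shape \<beta> t m" "orbit_shape \<beta> t' m'"
  shows "t = t' \<and> m = m'"
proof -
  have "t + m = t' + m'"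
    using assms card_image unfolding orbit_shape_def by (metis card_lessThan)
  moreover from this have "crit_iter \<beta> t = crit_iter \<beta> t'"
    using assms by (simp add: orbit_shape_def)
  moreover have "t < t + m" "t' < t' + m'"
    using assms by (auto simp: orbit_shape_def)
  ultimately have "t = t'"
    using assms(1) unfolding orbit_shape_def inj_on_def by (metis lessThan_iff)
  with \<open>t + m = t' + m'\<close> show ?thesis by simp
qed

end

(* Summability: between two adjacent preimages of c_t under f^n there is a turning point of f^n,
   whose value is another point of the critical orbit. As the critical orbit is finite and f^n is
   \<beta>^n-Lipschitz, adjacent preimages are at least d / \<beta>^n apart, so there are O(\<beta>^n) of them.

   Density: suppose no parameter in an interval has a critical orbit that returns to the critical
   point. Then all those parameters share the same itinerary of the critical orbit, hence the same
   kneading series, a power series with coefficients 1 and -1. It vanishes at 1/\<beta> for every \<beta> in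
   the interval, so it vanishes identically by the identity theorem; but its constant term is 1. *)
theory Submission
  imports Defs "HOL-Complex_Analysis.Complex_Analysis"
begin

section \<open>Counting preimages\<close>

text \<open>Writing the fold as an absolute value gives continuity in the point and in the
  parameter, as well as the Lipschitz bound, without splitting into branches.\<close>

lemma tent_eq_abs: "tent \<beta> x = \<beta> * (1/2 - \<bar>x - 1/2\<bar>)"
  by (auto simp: tent_def algebra_simps)

lemma continuous_on_tent_iter:
  "continuous_on S (\<lambda>x. (tent \<beta> ^^ n) x)"
  by (induction n) (auto simp: tent_eq_abs intro!: continuous_intros)

lemma tent_iter_lipschitz:
  assumes "0 \<le> \<beta>"
  shows "\<bar>(tent \<beta> ^^ n) x - (tent \<beta> ^^ n) y\<bar> \<le> \<beta> ^ n * \<bar>x - y\<bar>"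
proof (induction n)
  case (Suc n)
  have "\<bar>tent \<beta> u - tent \<beta> v\<bar> \<le> \<beta> * \<bar>u - v\<bar>" for u v
  proof -
    have "tent \<beta> u - tent \<beta> v = \<beta> * (\<bar>v - 1/2\<bar> - \<bar>u - 1/2\<bar>)"
      by (simp add: tent_eq_abs algebra_simps)
    also have "\<bar>\<dots>\<bar> \<le> \<beta> * \<bar>u - v\<bar>"
      using assms by (auto simp: abs_mult intro!: mult_left_mono)
    finally show ?thesis .
  qed
  then have "\<bar>(tent \<beta> ^^ Suc n) x - (tent \<beta> ^^ Suc n) y\<bar>
      \<le> \<beta> * \<bar>(tent \<beta> ^^ n) x - (tent \<beta> ^^ n) y\<bar>"
    by simp
  also have "\<dots> \<le> \<beta> * (\<beta> ^ n * \<bar>x - y\<bar>)"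
    using Suc.IH assms by (rule mult_left_mono)
  finally show ?case by (simp add: mult.assoc)
qed simp

text \<open>A Rolle-type argument that peels off the last application of the map. If the iterates of
  \<open>u\<close> and \<open>w\<close> still differ before that step, they are mirror images about
  1/2, so the intermediate value theorem gives a crossing of 1/2 between them; otherwise the
  induction hypothesis applies.\<close>

lemma turning_point_between:
  assumes "0 < \<beta>" "u < w" "(tent \<beta> ^^ n) u = (tent \<beta> ^^ n) w"
  shows "\<exists>z k. u < z \<and> z < w \<and> k < n \<and> (tent \<beta> ^^ k) z = crit"
  using assms(3)
proof (induction n)
  case 0
  then show ?case using \<open>u < w\<close> by simp
next
  case (Suc n)
  let ?g = "\<lambda>x. (tent \<beta> ^^ n) x"
  show ?case
  proof (cases "?g u = ?g w")
    case True
    then show ?thesis using Suc.IH less_SucI by blast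
  next
    case False
    have "\<bar>?g u - 1/2\<bar> = \<bar>?g w - 1/2\<bar>"
      using Suc.prems \<open>0 < \<beta>\<close> by (simp add: tent_eq_abs[of \<beta> "?g _"])
    with False have "?g u < 1/2 \<and> 1/2 < ?g w \<or> ?g w < 1/2 \<and> 1/2 < ?g u"
      by linarith
    moreover have "\<exists>z\<ge>u. z \<le> w \<and> ?g z = 1/2" if "?g u < 1/2" "1/2 < ?g w"
      using IVT'[of ?g u "1/2" w] that \<open>u < w\<close> continuous_on_tent_iter by auto
    moreover have "\<exists>z\<ge>u. z \<le> w \<and> ?g z = 1/2" if "?g w < 1/2" "1/2 < ?g u"
      using IVT2'[of ?g w "1/2" u] that \<open>u < w\<close> continuous_on_tent_iter by auto
    ultimately obtain z where z: "u \<le> z" "z \<le> w" "?g z = 1/2" "?g u \<noteq> 1/2" "?g w \<noteq> 1/2"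
      by auto
    then have "u < z" "z < w"
      by (auto simp: order_less_le)
    with z show ?thesis by (auto simp: crit_def)
  qed
qed

text \<open>Pigeonhole: cut the line into cells of length \<open>r\<close>. Points at least
  \<open>r\<close> apart have distinct cell indices \<open>\<lfloor>x / r\<rfloor>\<close>.\<close>

lemma card_separated_le:
  fixes S :: "real set"
  assumes "S \<subseteq> {0..1}" "0 < r" "\<And>x y. x \<in> S \<Longrightarrow> y \<in> S \<Longrightarrow> x < y \<Longrightarrow> r \<le> y - x"
  shows "real (card S) \<le> 1 + 1 / r"
proof -
  let ?q = "\<lambda>x. \<lfloor>x / r\<rfloor>"
  have "inj_on ?q S"
  proof (rule linorder_inj_onI)
    fix x y assume xy: "x < y" "x \<in> S" "y \<in> S"
    then have "(x + r) / r \<le> y / r"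
      using assms(2) assms(3)[of x y] by (intro divide_right_mono) auto
    then have "x / r + 1 \<le> y / r"
      using assms(2) by (simp add: add_divide_distrib)
    then show "?q x \<noteq> ?q y" by linarith
  qed auto
  moreover have "?q ` S \<subseteq> {0..\<lfloor>1 / r\<rfloor>}"
    using assms(1,2) by (fastforce intro!: floor_mono divide_right_mono)
  ultimately have "card S \<le> card {0..\<lfloor>1 / r\<rfloor>}"
    by (rule card_inj_on_le) simp
  moreover have "real (card {0..\<lfloor>1 / r\<rfloor>}) \<le> 1 + 1 / r"
    using \<open>0 < r\<close> by simp
  ultimately show ?thesis by linarith
qed

lemma preimages_separated:
  assumes "1 < \<beta>"
    and gap: "\<And>p. p \<in> crit_orbit \<beta> \<Longrightarrow> p \<noteq> y \<Longrightarrow> d \<le> \<bar>p - y\<bar>"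
    and xw: "(tent \<beta> ^^ n) x = y" "(tent \<beta> ^^ n) w = y" "x < w"
  shows "d / \<beta> ^ n \<le> w - x"
proof -
  \<comment> \<open>Replacing \<open>w\<close> by the first preimage \<open>v\<close> to the right
    of \<open>x\<close> ensures that the turning point found between them is not itself mapped to
    \<open>y\<close>, so \<open>gap\<close> applies to its image.\<close>
  let ?P = "{v. (tent \<beta> ^^ n) v = y \<and> x < v}"
  define v where "v = Min ?P"
  have fin: "finite ?P"
    using finite_tent_preimage[OF \<open>1 < \<beta>\<close>, of n y] by (rule finite_subset[rotated]) auto
  have "v \<in> ?P"
    unfolding v_def using fin xw by (intro Min_in) auto
  have "v \<le> w"
    unfolding v_def using fin xw by (intro Min_le) auto
  have adjacent: "(tent \<beta> ^^ n) z \<noteq> y" if "x < z" "z < v" for z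
    using that Min_le[OF fin, of z] unfolding v_def by auto
  obtain z k where z: "x < z" "z < v" "k < n" "(tent \<beta> ^^ k) z = crit"
    using turning_point_between[of \<beta> x v n] \<open>v \<in> ?P\<close> xw \<open>1 < \<beta>\<close> by auto
  have "(tent \<beta> ^^ n) z = (tent \<beta> ^^ (n - k)) ((tent \<beta> ^^ k) z)"
    using \<open>k < n\<close> by (simp flip: funpow_add comp_apply[of "tent \<beta> ^^ (n - k)"])
  then have "(tent \<beta> ^^ n) z \<in> crit_orbit \<beta>"
    using z by (auto simp: crit_orbit_def crit_iter_def)
  then have "d \<le> \<bar>(tent \<beta> ^^ n) z - (tent \<beta> ^^ n) x\<bar>"
    using gap adjacent z xw by simp
  also have "\<dots> \<le> \<beta> ^ n * \<bar>z - x\<bar>"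
    using tent_iter_lipschitz \<open>1 < \<beta>\<close> by simp
  also have "\<dots> \<le> \<beta> ^ n * (w - x)"
    using z \<open>v \<le> w\<close> \<open>1 < \<beta>\<close> by (intro mult_left_mono) auto
  finally show ?thesis
    using \<open>1 < \<beta>\<close> by (simp add: field_simps)
qed

lemma F_num_bound:
  assumes "1 < \<beta>" "finite (crit_orbit \<beta>)"
  obtains K where "\<And>n. real (F_num \<beta> n) \<le> K * \<beta> ^ n"
proof -
  let ?y = "crit_iter \<beta> (preperiod \<beta>)"
  \<comment> \<open>Finiteness of the critical orbit gives a positive lower bound on the distance
    from \<open>?y\<close> to its other points.\<close>
  obtain d where d: "0 < d" "\<And>p. p \<in> crit_orbit \<beta> \<Longrightarrow> p \<noteq> ?y \<Longrightarrow> d \<le> \<bar>p - ?y\<bar>"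
    using finite_set_avoid[OF assms(2), of ?y] by (auto simp: dist_real_def abs_minus_commute)
  have "real (F_num \<beta> n) \<le> (1 + 1 / d) * \<beta> ^ n" for n
  proof -
    have "real (F_num \<beta> n) \<le> 1 + 1 / (d / \<beta> ^ n)"
      unfolding F_num_def
    proof (rule card_separated_le)
      show "d / \<beta> ^ n \<le> w - x" if "x \<in> C_set \<beta> n" "w \<in> C_set \<beta> n" "x < w" for x w
        using preimages_separated[OF assms(1) d(2)] that by (auto simp: C_set_def)
    qed (use d assms in \<open>auto simp: C_set_def\<close>)
    \<comment> \<open>The additive 1 is absorbed because 1 \<le> \<open>\<beta> ^ n\<close>.\<close>
    also have "\<dots> \<le> (1 + 1 / d) * \<beta> ^ n"
      using assms by (simp add: algebra_simps one_le_power)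
    finally show ?thesis .
  qed
  then show thesis using that by blast
qed

text \<open>The factor \<open>1 / \<beta> ^ n\<close> in \<open>a_coeff\<close> cancels the growth
  of \<open>F_num\<close>, leaving a comparison with the sum of inverse squares.\<close>

lemma summable_F_num:
  assumes "1 < \<beta>" "finite (crit_orbit \<beta>)"
  shows "summable (\<lambda>n. real (F_num \<beta> (Suc n)) * a_coeff \<beta> (Suc n))"
proof -
  obtain K where K: "\<And>n. real (F_num \<beta> n) \<le> K * \<beta> ^ n"
    using F_num_bound[OF assms] by blast
  have "summable (\<lambda>n. 2 * K * inverse (real (Suc n) ^ 2))"
    using summable_Suc_iff[THEN iffD2, OF inverse_power_summable[of 2, where 'a=real]]
    by (intro summable_mult) auto
  then show ?thesis
  proof (rule summable_comparison_test')
    fix n :: nat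
    let ?N = "Suc n"
    have "0 \<le> K" using K[of 0] by simp
    have "real (F_num \<beta> ?N) * a_coeff \<beta> ?N \<le> K * \<beta> ^ ?N * a_coeff \<beta> ?N"
      using assms K[of ?N] by (intro mult_right_mono) (auto simp: a_coeff_def)
    also have "\<dots> = K * (2 / (real ?N * (real ?N + 1)))"
      using assms by (simp add: a_coeff_def)
    also have "\<dots> \<le> K * (2 / (real ?N * real ?N))"
      using \<open>0 \<le> K\<close> by (intro mult_left_mono divide_left_mono) auto
    finally show "norm (real (F_num \<beta> ?N) * a_coeff \<beta> ?N) \<le> 2 * K * inverse (real ?N ^ 2)"
      using assms by (simp add: a_coeff_def power2_eq_square field_simps)
  qed
qed

section \<open>Density of the parameters with finite critical orbit\<close>

lemma crit_iter_Suc: "crit_iter \<beta> (Suc n) = tent \<beta> (crit_iter \<beta> n)"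
  by (simp add: crit_iter_def)

lemma crit_iter_unit:
  assumes "1 < \<beta>" "\<beta> \<le> 2"
  shows "crit_iter \<beta> n \<in> {0..1}"
proof (induction n)
  case (Suc n)
  then show ?case using tent_maps_unit[OF assms] by (simp add: crit_iter_Suc)
qed (simp add: crit_iter_def crit_def)

text \<open>The variable here is the parameter. This is what lets a change of itinerary between two
  parameters force a return to the critical point at some parameter in between.\<close>

lemma continuous_on_crit_iter: "continuous_on S (\<lambda>\<beta>. crit_iter \<beta> n)"
proof (induction n)
  case (Suc n)
  then show ?case
    by (auto simp: crit_iter_Suc tent_eq_abs intro!: continuous_intros)
qed (simp add: crit_iter_def)

lemma finite_crit_orbit_if_return:
  assumes "crit_iter \<beta> (Suc n) = crit"
  shows "finite (crit_orbit \<beta>)"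
proof -
  have "crit_iter \<beta> i = crit_iter \<beta> (i mod Suc n)" for i
    using assms funpow_mod_eq[where f = "tent \<beta>" and n = "Suc n" and x = crit and m = i] by (simp add: crit_iter_def)
  then have "crit_orbit \<beta> \<subseteq> crit_iter \<beta> ` {..<Suc n}"
    unfolding crit_orbit_def by (metis image_subsetI imageI lessThan_iff mod_less_divisor zero_less_Suc)
  then show ?thesis by (rule finite_subset) simp
qed

text \<open>The sequence \<open>s\<close> is the itinerary of the critical orbit, and the series is its kneading series.\<close>
lemma kneading_series_sums_0:
  assumes "1 < \<beta>" "\<beta> \<le> 2"
    and s: "\<And>n. sgn (crit_iter \<beta> (Suc n) - 1/2) = s n" "\<And>n. s n \<noteq> 0"
  shows "(\<lambda>n. (\<Prod>i<n. - s i) * (1 / \<beta>) ^ n) sums 0"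
proof -
  \<comment> \<open>\<open>u\<close> is the orbit of the critical value centred at 1/2. A sign
    \<open>s i\<close> of 1 means the right branch, of slope -\<beta>, so
    \<open>E n * \<beta> ^ n\<close> is the slope of the n-th iterate at the critical value.\<close>
  define u where "u n = crit_iter \<beta> (Suc n) - 1/2" for n
  define E where "E n = (\<Prod>i<n. - s i)" for n
  have s_sq: "s n * s n = 1" for n
    using s(2)[of n] unfolding s(1)[of n, symmetric]
    by (auto simp: sgn_if split: if_splits)
  have abs_s: "\<bar>s n\<bar> = 1" for n
    using s_sq[of n] by (auto simp: square_eq_1_iff)
  have abs_E: "\<bar>E n\<bar> = 1" for n
    by (simp add: E_def abs_prod abs_s)
  have u_Suc: "u (Suc n) = (\<beta> - 1) / 2 - \<beta> * (s n * u n)" for n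
  proof -
    have "s n * u n = \<bar>u n\<bar>"
      unfolding u_def s(1)[symmetric] by (subst mult.commute) (rule abs_sgn[symmetric])
    moreover have "u (Suc n) = \<beta> * (1/2 - \<bar>u n\<bar>) - 1/2"
      unfolding u_def by (simp only: crit_iter_Suc[of \<beta> "Suc n"] tent_eq_abs)
    ultimately show ?thesis by (simp add: algebra_simps)
  qed
  \<comment> \<open>Since \<open>E (Suc n) * s n = - E n\<close>, multiplying the recurrence for
    \<open>u\<close> by \<open>E (Suc n) * (1 / \<beta>) ^ Suc n\<close> makes it telescope. The
    base case is \<open>u 0 = (\<beta> - 1) / 2\<close>.\<close>
  have partial: "(\<beta> - 1) / 2 * (\<Sum>k<Suc n. E k * (1 / \<beta>) ^ k) = E n * u n * (1 / \<beta>) ^ n" for n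
  proof (induction n)
    case 0
    show ?case by (simp add: E_def u_def crit_iter_def crit_def tent_def field_simps)
  next
    case (Suc n)
    have "E (Suc n) * u (Suc n) * (1 / \<beta>) ^ Suc n
        = (\<beta> - 1) / 2 * (E (Suc n) * (1 / \<beta>) ^ Suc n) + E n * (s n * s n) * u n * (1 / \<beta>) ^ n"
    proof -
      have "E (Suc n) * u (Suc n) * (1 / \<beta>) ^ Suc n
          = (\<beta> - 1) / 2 * (E (Suc n) * (1 / \<beta>) ^ Suc n)
            - E (Suc n) * s n * u n * (\<beta> * (1 / \<beta>) ^ Suc n)"
        by (simp only: u_Suc algebra_simps)
      also have "\<beta> * (1 / \<beta>) ^ Suc n = (1 / \<beta>) ^ n"
        using \<open>1 < \<beta>\<close> by simp
      finally show ?thesis by (simp add: E_def)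
    qed
    then show ?case
      using Suc.IH by (simp add: s_sq distrib_left)
  qed
  have "(\<lambda>n. E n * u n * (1 / \<beta>) ^ n) \<longlonglongrightarrow> 0"
  proof (rule Lim_null_comparison)
    show "\<forall>\<^sub>F n in sequentially. norm (E n * u n * (1 / \<beta>) ^ n) \<le> (1 / \<beta>) ^ n"
    proof (intro always_eventually allI)
      fix n
      have "\<bar>u n\<bar> \<le> 1"
        using crit_iter_unit[OF assms(1,2), of "Suc n"] by (auto simp: u_def)
      then show "norm (E n * u n * (1 / \<beta>) ^ n) \<le> (1 / \<beta>) ^ n"
        using \<open>1 < \<beta>\<close> by (simp add: abs_mult abs_E mult_left_le_one_le)
    qed
    show "(\<lambda>n. (1 / \<beta>) ^ n) \<longlonglongrightarrow> 0"
      using \<open>1 < \<beta>\<close> by (intro LIMSEQ_realpow_zero) auto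
  qed
  then have "(\<lambda>n. (\<beta> - 1) / 2 * (\<Sum>k<Suc n. E k * (1 / \<beta>) ^ k)) \<longlonglongrightarrow> (\<beta> - 1) / 2 * 0"
    by (simp only: partial mult_zero_right)
  then have "(\<lambda>n. \<Sum>k<Suc n. E k * (1 / \<beta>) ^ k) \<longlonglongrightarrow> 0"
    using \<open>1 < \<beta>\<close> by (subst (asm) tendsto_mult_left_iff) auto
  then show ?thesis
    unfolding sums_def E_def by (rule LIMSEQ_imp_Suc)
qed

text \<open>Bounded coefficients make the series holomorphic on the complex unit disc. Its zeros on
  the real interval accumulate inside the disc, so the identity theorem carries the vanishing to 0,
  where the value is the constant coefficient.\<close>

lemma power_series_zero_on_interval:
  fixes e :: "nat \<Rightarrow> real"
  assumes e: "\<And>n. \<bar>e n\<bar> \<le> 1"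
    and pq: "0 \<le> p" "p < q" "q \<le> 1"
    and zero: "\<And>x. p < x \<Longrightarrow> x < q \<Longrightarrow> (\<lambda>n. e n * x ^ n) sums 0"
  shows "e 0 = 0"
proof -
  define f where "f z = (\<Sum>n. complex_of_real (e n) * z ^ n)" for z
  have sums: "(\<lambda>n. complex_of_real (e n) * z ^ n) sums f z" if "z \<in> ball 0 1" for z
  proof -
    have "summable (\<lambda>n. complex_of_real (e n) * z ^ n)"
    proof (rule summable_comparison_test')
      show "summable (\<lambda>n. norm z ^ n)"
        using that by (simp add: summable_geometric)
      show "norm (complex_of_real (e n) * z ^ n) \<le> norm z ^ n" for n
        using e[of n] by (simp add: norm_mult norm_power mult_left_le_one_le)
    qed
    then show ?thesis by (simp add: f_def summable_sums)
  qed
  have holo: "f holomorphic_on ball 0 1"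
    using sums by (intro power_series_holomorphic[of 0 1 "\<lambda>n. complex_of_real (e n)"]) simp
  define m where "m = (p + q) / 2"
  have m: "p < m" "m < q"
    using pq by (auto simp: m_def)
  have "m islimpt {p<..<q}"
    using m by (intro interior_limit_point) simp
  \<comment> \<open>The real limit point becomes a complex one by embedding an approximating
    sequence.\<close>
  then have limpt: "complex_of_real m islimpt complex_of_real ` {p<..<q}"
    unfolding islimpt_sequential
    apply (elim exE conjE)
    subgoal for X
      by (rule exI[of _ "\<lambda>n. complex_of_real (X n)"]) (auto intro!: tendsto_of_real)
    done
  have "f 0 = 0"
  proof (rule analytic_continuation[OF holo _ _ _ _ limpt])
    show "f z = 0" if z: "z \<in> complex_of_real ` {p<..<q}" for z
    proof -
      obtain x where x: "z = complex_of_real x" "p < x" "x < q"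
        using z by auto
      have "(\<lambda>n. complex_of_real (e n) * z ^ n) sums complex_of_real 0"
        using sums_of_real[OF zero[OF x(2,3)], where 'a = complex] x(1) by simp
      moreover have "z \<in> ball 0 1"
        using x pq by simp
      ultimately show ?thesis
        using sums sums_unique2 by fastforce
    qed
  qed (use pq m in auto)
  then show ?thesis
    using powser_zero[of "\<lambda>n. complex_of_real (e n)"] by (simp add: f_def)
qed

lemma exists_finite_orbit_param:
  assumes ab: "1 < a" "a < b" "b \<le> 2"
  shows "\<exists>\<beta>\<in>{a<..<b}. \<beta> \<in> finite_orbit_params"
proof (rule ccontr)
  assume contra: "\<not> ?thesis"
  \<comment> \<open>By contradiction no parameter in the interval has a finite critical orbit, so
    none returns to 1/2 and every itinerary sign is nonzero.\<close>
  have never: "crit_iter \<beta> (Suc n) \<noteq> 1/2" if "\<beta> \<in> {a<..<b}" for \<beta> n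
    using contra that ab finite_crit_orbit_if_return[of \<beta> n]
    by (fastforce simp: finite_orbit_params_def crit_def)
  define m where "m = (a + b) / 2"
  have m: "m \<in> {a<..<b}"
    using ab by (auto simp: m_def)
  define s where "s n = sgn (crit_iter m (Suc n) - 1/2)" for n
  have s_nz: "s n \<noteq> 0" for n
    using never[OF m] by (simp add: s_def sgn_eq_0_iff)
  \<comment> \<open>If the signs differed at two parameters, the connected image of the interval
    under \<open>?h\<close> would contain 1/2, which \<open>never\<close> excludes.\<close>
  have same: "sgn (crit_iter \<beta> (Suc n) - 1/2) = s n" if "\<beta> \<in> {a<..<b}" for \<beta> n
  proof (rule ccontr)
    assume differ: "\<not> ?thesis"
    let ?h = "\<lambda>\<beta>. crit_iter \<beta> (Suc n)"
    have "connected (?h ` {a<..<b})"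
      by (intro connected_continuous_image continuous_on_crit_iter) simp
    moreover have "?h \<beta> \<in> ?h ` {a<..<b}" "?h m \<in> ?h ` {a<..<b}"
      using that m by auto
    moreover have "?h \<beta> \<le> 1/2 \<and> 1/2 \<le> ?h m \<or> ?h m \<le> 1/2 \<and> 1/2 \<le> ?h \<beta>"
      using differ never[OF that, of n] never[OF m, of n]
      by (auto simp: s_def sgn_if split: if_splits)
    ultimately have "1/2 \<in> ?h ` {a<..<b}"
      using connectedD_interval by blast
    then show False using never by auto
  qed
  \<comment> \<open>The constant coefficient is an empty product, hence 1, so its vanishing is the
    contradiction. The series variable is \<open>1 / \<beta>\<close>, which runs over (1/b,
    1/a).\<close>
  have "(\<Prod>i<0. - s i) = 0"
  proof (rule power_series_zero_on_interval[where p = "1 / b" and q = "1 / a"])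
    have abs_s: "\<bar>s i\<bar> = 1" for i
      using s_nz[of i] by (auto simp: s_def sgn_if split: if_splits)
    show "\<bar>\<Prod>i<n. - s i\<bar> \<le> 1" for n
      by (simp add: abs_prod abs_s)
    fix x assume x: "1 / b < x" "x < 1 / a"
    have "0 < x"
      using x ab by (intro order_less_trans[OF _ x(1)]) simp
    then have "1 / x \<in> {a<..<b}"
      using x ab by (auto simp: field_simps)
    then show "(\<lambda>n. (\<Prod>i<n. - s i) * x ^ n) sums 0"
      using kneading_series_sums_0[of "1 / x" s] same s_nz ab by auto
  qed (use ab in \<open>auto simp: field_simps\<close>)
  then show False by simp
qed

theorem proposition1:
  shows "{1<..2} \<subseteq> closure finite_orbit_params \<and>
         (\<forall>\<beta>\<in>finite_orbit_params. summable (\<lambda>n. real (F_num \<beta> (Suc n)) * a_coeff \<beta> (Suc n)))"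
proof (intro conjI subsetI ballI)
  fix \<beta> :: real assume \<beta>: "\<beta> \<in> {1<..2}"
  show "\<beta> \<in> closure finite_orbit_params"
    unfolding closure_approachable
  proof (intro allI impI)
    fix r :: real assume "0 < r"
    \<comment> \<open>The left endpoint is chosen to stay above 1 and within \<open>r\<close> of
      \<beta>. Approaching from the left also covers \<beta> = 2.\<close>
    have "1 < max ((1 + \<beta>) / 2) (\<beta> - r)" "max ((1 + \<beta>) / 2) (\<beta> - r) < \<beta>"
      using \<beta> \<open>0 < r\<close> by (auto simp: less_max_iff_disj)
    then obtain \<gamma> where "\<gamma> \<in> {max ((1 + \<beta>) / 2) (\<beta> - r)<..<\<beta>}" "\<gamma> \<in> finite_orbit_params"
      using exists_finite_orbit_param \<beta> by (metis greaterThanAtMost_iff)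
    then show "\<exists>\<gamma>\<in>finite_orbit_params. dist \<gamma> \<beta> < r"
      by (intro bexI[of _ \<gamma>]) (auto simp: dist_real_def)
  qed
next
  fix \<beta> assume "\<beta> \<in> finite_orbit_params"
  then show "summable (\<lambda>n. real (F_num \<beta> (Suc n)) * a_coeff \<beta> (Suc n))"
    by (intro summable_F_num) (auto simp: finite_orbit_params_def)
qed

end
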